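(* The propositional fragment of $LJ^+$ coincides with classical propositional logic: for every propositional formula $A$, the sequent $\vdash A$ is derivable in $LJ^+$ if and only if $\vdash A$ is derivable in $LK$.
   Context: Formulas are first-order formulas without function symbols and without object constants, built from propositional symbols (relation symbols of arity $0$), predicate symbols (relation symbols of arity at least $1$), the logical constants $\top,\bot$, the connectives $\&,\lor,\neg,\supset$ and the quantifiers $\forall,\exists$; quantified formulas $\forall x\,F(x)$, $\exists x\,F(x)$ are formed only from $F(x)$ in which $x$ occurs free. $\top,\bot$ are not counted as propositional or predicate symbols. A formula is propositional if it contains only propositional symbols (no predicate symbols). A sequent is $\Gamma\vdash\Lambda$ with $\Gamma$ a finite, possibly empty sequence of formulas and $\Lambda$ either a single formula or empty. The calculus $LJ$ (Gentzen's intuitionistic sequent calculus) has axioms $A\vdash A$ (any formula $A$), $\vdash\top$, $\bot\vdash$, and the following rules (premises / conclusion). Thinning: $\Gamma\vdash\Lambda\,/\,A,\Gamma\vdash\Lambda$; $\Gamma\vdash\,/\,\Gamma\vdash A$. Contraction: $A,A,\Gamma\vdash\Lambda\,/\,A,\Gamma\vdash\Lambda$. Exchange: $\Pi,A,B,\Gamma\vdash\Lambda\,/\,\Pi,B,A,\Gamma\vdash\Lambda$. Cut: $\Gamma\vdash C$ and $C,\Pi\vdash\Lambda\,/\,\Gamma,\Pi\vdash\Lambda$. $\&$: $\Gamma\vdash A$ and $\Gamma\vdash B\,/\,\Gamma\vdash A\&B$; $A,\Gamma\vdash\Lambda\,/\,A\&B,\Gamma\vdash\Lambda$; $B,\Gamma\vdash\Lambda\,/\,A\&B,\Gamma\vdash\Lambda$.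 $\lor$: $A,\Gamma\vdash\Lambda$ and $B,\Gamma\vdash\Lambda\,/\,A\lor B,\Gamma\vdash\Lambda$; $\Gamma\vdash A\,/\,\Gamma\vdash A\lor B$; $\Gamma\vdash B\,/\,\Gamma\vdash A\lor B$. $\neg$: $A,\Gamma\vdash\,/\,\Gamma\vdash\neg A$; $\Gamma\vdash A\,/\,\neg A,\Gamma\vdash$. $\supset$: $A,\Gamma\vdash B\,/\,\Gamma\vdash A\supset B$; $\Gamma\vdash A$ and $B,\Pi\vdash\Lambda\,/\,A\supset B,\Gamma,\Pi\vdash\Lambda$. $\forall$: $\Gamma\vdash F(a)\,/\,\Gamma\vdash\forall x\,F(x)$; $F(a),\Gamma\vdash\Lambda\,/\,\forall x\,F(x),\Gamma\vdash\Lambda$. $\exists$: $\Gamma\vdash F(a)\,/\,\Gamma\vdash\exists x\,F(x)$; $F(a),\Gamma\vdash\Lambda\,/\,\exists x\,F(x),\Gamma\vdash\Lambda$. Here $a$ is a variable and $F(a)$ is the result of (capture-free) substitution of $a$ for $x$ in $F(x)$; in the $\forall$-succedent and $\exists$-antecedent rules $a$ (the eigenvariable) must not occur in the conclusion. $LJ^+$ is $LJ$ extended with the neutralization rule: $N,\Gamma\vdash\Lambda$ and $\neg N,\Gamma\vdash\Lambda\,/\,\Gamma\vdash\Lambda$, where $N$ must be a propositional formula. $LK$ (classical logic) is $LJ$ plus the axiom schema $\vdash A\lor\neg A$ for every formula $A$. A formula $A$ is derivable in a calculus if the sequent $\vdash A$ is. *)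

theory Defs
  imports Main
begin

text \<open>
  The language is given by an arbitrary type \<open>'r\<close> of relation symbols together with an arity
  function \<open>ar\<close>, which is a parameter of everything that depends on it. Symbols of arity 0 are the
  propositional symbols, all the others are the predicate symbols. There are no function symbols or
  object constants, so the arguments of an atom are variables.
\<close>

type_synonym var = nat

datatype (symbols: 'r) fm =
    Atom 'r "var list"
  | Verum
  | Falsum
  | Conj "'r fm" "'r fm"
  | Disj "'r fm" "'r fm"
  | Neg "'r fm"
  | Imp "'r fm" "'r fm"
  | Forall var "'r fm"
  | Exists var "'r fm"

fun free_vars :: "'r fm \<Rightarrow> var set" where
  "free_vars (Atom r xs) = set xs"
| "free_vars Verum = {}"
| "free_vars Falsum = {}"
| "free_vars (Conj A B) = free_vars A \<union> free_vars B"
| "free_vars (Disj A B) = free_vars A \<union> free_vars B"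
| "free_vars (Neg A) = free_vars A"
| "free_vars (Imp A B) = free_vars A \<union> free_vars B"
| "free_vars (Forall x A) = free_vars A - {x}"
| "free_vars (Exists x A) = free_vars A - {x}"

text \<open>All variables with an occurrence of any kind: free, bound, or next to a quantifier.\<close>

fun vars :: "'r fm \<Rightarrow> var set" where
  "vars (Atom r xs) = set xs"
| "vars Verum = {}"
| "vars Falsum = {}"
| "vars (Conj A B) = vars A \<union> vars B"
| "vars (Disj A B) = vars A \<union> vars B"
| "vars (Neg A) = vars A"
| "vars (Imp A B) = vars A \<union> vars B"
| "vars (Forall x A) = insert x (vars A)"
| "vars (Exists x A) = insert x (vars A)"

text \<open>
  The formulas are those elements of \<open>'r fm\<close> that respect arities and in which a quantifier is only
  applied to a formula where its variable occurs free.
\<close>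

fun formula :: "('r \<Rightarrow> nat) \<Rightarrow> 'r fm \<Rightarrow> bool" where
  "formula ar (Atom r xs) \<longleftrightarrow> length xs = ar r"
| "formula ar Verum \<longleftrightarrow> True"
| "formula ar Falsum \<longleftrightarrow> True"
| "formula ar (Conj A B) \<longleftrightarrow> formula ar A \<and> formula ar B"
| "formula ar (Disj A B) \<longleftrightarrow> formula ar A \<and> formula ar B"
| "formula ar (Neg A) \<longleftrightarrow> formula ar A"
| "formula ar (Imp A B) \<longleftrightarrow> formula ar A \<and> formula ar B"
| "formula ar (Forall x A) \<longleftrightarrow> formula ar A \<and> x \<in> free_vars A"
| "formula ar (Exists x A) \<longleftrightarrow> formula ar A \<and> x \<in> free_vars A"

text \<open>Such formulas are automatically free of quantifiers, by the restriction just made.\<close>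

definition propositional :: "('r \<Rightarrow> nat) \<Rightarrow> 'r fm \<Rightarrow> bool" where
  "propositional ar A \<longleftrightarrow> formula ar A \<and> (\<forall>r \<in> symbols A. ar r = 0)"

text \<open>
  \<open>subst x a F\<close> replaces the free occurrences of \<open>x\<close> in \<open>F\<close> by \<open>a\<close>, without renaming bound
  variables. It is used only when \<open>free_for a x F\<close> holds, that is, when no such occurrence lies in
  the scope of a quantifier binding \<open>a\<close>.
\<close>

fun subst :: "var \<Rightarrow> var \<Rightarrow> 'r fm \<Rightarrow> 'r fm" where
  "subst x a (Atom r xs) = Atom r (map (\<lambda>y. if y = x then a else y) xs)"
| "subst x a Verum = Verum"
| "subst x a Falsum = Falsum"
| "subst x a (Conj A B) = Conj (subst x a A) (subst x a B)"
| "subst x a (Disj A B) = Disj (subst x a A) (subst x a B)"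
| "subst x a (Neg A) = Neg (subst x a A)"
| "subst x a (Imp A B) = Imp (subst x a A) (subst x a B)"
| "subst x a (Forall y A) = (if y = x then Forall y A else Forall y (subst x a A))"
| "subst x a (Exists y A) = (if y = x then Exists y A else Exists y (subst x a A))"

fun free_for :: "var \<Rightarrow> var \<Rightarrow> 'r fm \<Rightarrow> bool" where
  "free_for a x (Atom r xs) \<longleftrightarrow> True"
| "free_for a x Verum \<longleftrightarrow> True"
| "free_for a x Falsum \<longleftrightarrow> True"
| "free_for a x (Conj A B) \<longleftrightarrow> free_for a x A \<and> free_for a x B"
| "free_for a x (Disj A B) \<longleftrightarrow> free_for a x A \<and> free_for a x B"
| "free_for a x (Neg A) \<longleftrightarrow> free_for a x A"
| "free_for a x (Imp A B) \<longleftrightarrow> free_for a x A \<and> free_for a x B"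
| "free_for a x (Forall y A) \<longleftrightarrow> x \<in> free_vars (Forall y A) \<longrightarrow> y \<noteq> a \<and> free_for a x A"
| "free_for a x (Exists y A) \<longleftrightarrow> x \<in> free_vars (Exists y A) \<longrightarrow> y \<noteq> a \<and> free_for a x A"

datatype 'r sequent = Sequent (antecedent: "'r fm list") (succedent: "'r fm option")
  (infix "\<turnstile>" 50)

definition sequent_fms :: "'r sequent \<Rightarrow> 'r fm set" where
  "sequent_fms S = set (antecedent S) \<union> set_option (succedent S)"

definition sequent_vars :: "'r sequent \<Rightarrow> var set" where
  "sequent_vars S = (\<Union>F \<in> sequent_fms S. vars F)"

text \<open>
  A calculus is a relation between lists of premises and conclusions; axioms are rules without
  premises. That the sequents in a derivation consist of formulas is imposed once and for all in
  \<open>derivable_sequent\<close> instead of in the individual rules.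
\<close>

type_synonym 'r calculus = "'r sequent list \<Rightarrow> 'r sequent \<Rightarrow> bool"

inductive derivable_sequent :: "('r \<Rightarrow> nat) \<Rightarrow> 'r calculus \<Rightarrow> 'r sequent \<Rightarrow> bool"
  for ar :: "'r \<Rightarrow> nat" and R :: "'r calculus" where
  "R Ps S \<Longrightarrow> \<forall>P \<in> set Ps. derivable_sequent ar R P \<Longrightarrow> \<forall>F \<in> sequent_fms S. formula ar F
     \<Longrightarrow> derivable_sequent ar R S"

inductive LJ :: "'r calculus" where
  ax: "LJ [] ([A] \<turnstile> Some A)"
| ax_Verum: "LJ [] ([] \<turnstile> Some Verum)"
| ax_Falsum: "LJ [] ([Falsum] \<turnstile> None)"
| thin_left: "LJ [\<Gamma> \<turnstile> \<Lambda>] (A # \<Gamma> \<turnstile> \<Lambda>)"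
| thin_right: "LJ [\<Gamma> \<turnstile> None] (\<Gamma> \<turnstile> Some A)"
| contraction: "LJ [A # A # \<Gamma> \<turnstile> \<Lambda>] (A # \<Gamma> \<turnstile> \<Lambda>)"
| exchange: "LJ [\<Pi> @ A # B # \<Gamma> \<turnstile> \<Lambda>] (\<Pi> @ B # A # \<Gamma> \<turnstile> \<Lambda>)"
| cut: "LJ [\<Gamma> \<turnstile> Some C, C # \<Pi> \<turnstile> \<Lambda>] (\<Gamma> @ \<Pi> \<turnstile> \<Lambda>)"
| Conj_right: "LJ [\<Gamma> \<turnstile> Some A, \<Gamma> \<turnstile> Some B] (\<Gamma> \<turnstile> Some (Conj A B))"
| Conj_left1: "LJ [A # \<Gamma> \<turnstile> \<Lambda>] (Conj A B # \<Gamma> \<turnstile> \<Lambda>)"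
| Conj_left2: "LJ [B # \<Gamma> \<turnstile> \<Lambda>] (Conj A B # \<Gamma> \<turnstile> \<Lambda>)"
| Disj_left: "LJ [A # \<Gamma> \<turnstile> \<Lambda>, B # \<Gamma> \<turnstile> \<Lambda>] (Disj A B # \<Gamma> \<turnstile> \<Lambda>)"
| Disj_right1: "LJ [\<Gamma> \<turnstile> Some A] (\<Gamma> \<turnstile> Some (Disj A B))"
| Disj_right2: "LJ [\<Gamma> \<turnstile> Some B] (\<Gamma> \<turnstile> Some (Disj A B))"
| Neg_right: "LJ [A # \<Gamma> \<turnstile> None] (\<Gamma> \<turnstile> Some (Neg A))"
| Neg_left: "LJ [\<Gamma> \<turnstile> Some A] (Neg A # \<Gamma> \<turnstile> None)"
| Imp_right: "LJ [A # \<Gamma> \<turnstile> Some B] (\<Gamma> \<turnstile> Some (Imp A B))"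
| Imp_left: "LJ [\<Gamma> \<turnstile> Some A, B # \<Pi> \<turnstile> \<Lambda>] (Imp A B # \<Gamma> @ \<Pi> \<turnstile> \<Lambda>)"
| Forall_right: "LJ [\<Gamma> \<turnstile> Some (subst x a F)] (\<Gamma> \<turnstile> Some (Forall x F))"
    if "free_for a x F" and "a \<notin> sequent_vars (\<Gamma> \<turnstile> Some (Forall x F))"
| Forall_left: "LJ [subst x a F # \<Gamma> \<turnstile> \<Lambda>] (Forall x F # \<Gamma> \<turnstile> \<Lambda>)"
    if "free_for a x F"
| Exists_right: "LJ [\<Gamma> \<turnstile> Some (subst x a F)] (\<Gamma> \<turnstile> Some (Exists x F))"
    if "free_for a x F"
| Exists_left: "LJ [subst x a F # \<Gamma> \<turnstile> \<Lambda>] (Exists x F # \<Gamma> \<turnstile> \<Lambda>)"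
    if "free_for a x F" and "a \<notin> sequent_vars (Exists x F # \<Gamma> \<turnstile> \<Lambda>)"

inductive LJ_plus :: "('r \<Rightarrow> nat) \<Rightarrow> 'r calculus" for ar :: "'r \<Rightarrow> nat" where
  LJ: "LJ Ps S \<Longrightarrow> LJ_plus ar Ps S"
| neutralization: "LJ_plus ar [N # \<Gamma> \<turnstile> \<Lambda>, Neg N # \<Gamma> \<turnstile> \<Lambda>] (\<Gamma> \<turnstile> \<Lambda>)"
    if "propositional ar N"

inductive LK :: "'r calculus" where
  LJ: "LJ Ps S \<Longrightarrow> LK Ps S"
| excluded_middle: "LK [] ([] \<turnstile> Some (Disj A (Neg A)))"

definition derivable :: "('r \<Rightarrow> nat) \<Rightarrow> 'r calculus \<Rightarrow> 'r fm \<Rightarrow> bool" where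
  "derivable ar R A \<longleftrightarrow> derivable_sequent ar R ([] \<turnstile> Some A)"

end

theory Submission
  imports Defs
begin

text \<open>
  From left to right, neutralization is simulated in \<open>LK\<close>: \<open>Disj_left\<close> merges its two premises into
  one with \<open>N \<or> \<not>N\<close> in the antecedent, and a cut with the excluded middle for \<open>N\<close> removes that
  formula.

  From right to left, a derivation in \<open>LK\<close> of a propositional formula may still pass through
  formulas with quantifiers and predicate symbols, and may use the excluded middle for them, while
  neutralization is restricted to propositional formulas. The first-order part is removed from the
  whole derivation by \<open>erase\<close>, which deletes all quantifiers and replaces every atom with a predicate
  symbol by \<open>\<top>\<close>. It commutes with the connectives, is blind to substitution, yields only
  propositional formulas and fixes these. Hence it turns each instance of an \<open>LJ\<close> rule into an instance of the same rule or, for the quantifier rules,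
  into a step whose conclusion is its premise (\<open>LJ_erase\<close>); and it turns the excluded middle for an
  arbitrary formula into the excluded middle for a propositional one, which neutralization proves.
  So the erasure of an \<open>LK\<close> derivation is, step by step, an \<open>LJ\<^sup>+\<close> derivation
  (\<open>LJ_plus_derivable_erase\<close>), and a propositional end formula is left unchanged by it.
\<close>

section \<open>Erasing the first-order part of a formula\<close>

text \<open>
  A propositional symbol loses its arguments, which a well-formed atom does not have. This makes the
  result propositional even for elements of the type that are not formulas.
\<close>

fun erase :: "('r \<Rightarrow> nat) \<Rightarrow> 'r fm \<Rightarrow> 'r fm" where
  "erase ar (Atom r xs) = (if ar r = 0 then Atom r [] else Verum)"
| "erase ar Verum = Verum"
| "erase ar Falsum = Falsum"
| "erase ar (Conj A B) = Conj (erase ar A) (erase ar B)"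
| "erase ar (Disj A B) = Disj (erase ar A) (erase ar B)"
| "erase ar (Neg A) = Neg (erase ar A)"
| "erase ar (Imp A B) = Imp (erase ar A) (erase ar B)"
| "erase ar (Forall x A) = erase ar A"
| "erase ar (Exists x A) = erase ar A"

definition erase_sequent :: "('r \<Rightarrow> nat) \<Rightarrow> 'r sequent \<Rightarrow> 'r sequent" where
  "erase_sequent ar S =
     (map (erase ar) (antecedent S) \<turnstile> map_option (erase ar) (succedent S))"

lemma erase_sequent_simps [simp]:
  "erase_sequent ar (\<Gamma> \<turnstile> \<Lambda>) = (map (erase ar) \<Gamma> \<turnstile> map_option (erase ar) \<Lambda>)"
  by (simp add: erase_sequent_def)

lemma erase_subst [simp]: "erase ar (subst x a F) = erase ar F"
  by (induction F) auto

lemma propositional_erase: "propositional ar (erase ar A)"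
  by (induction A) (auto simp: propositional_def)

lemma formula_erase_sequent: "F \<in> sequent_fms (erase_sequent ar S) \<Longrightarrow> formula ar F"
  using propositional_erase
  by (cases S) (auto simp: sequent_fms_def propositional_def)

text \<open>
  A formula with a quantifier at its head has a free variable in the scope and hence a symbol of
  positive arity, so a propositional formula contains nothing to be erased.
\<close>

lemma free_vars_propositional: "propositional ar A \<Longrightarrow> free_vars A = {}"
  by (induction A) (auto simp: propositional_def)

lemma erase_propositional: "propositional ar A \<Longrightarrow> erase ar A = A"
proof (induction A)
  case (Forall x A)
  then have "propositional ar A" "x \<in> free_vars A"
    by (auto simp: propositional_def)
  then show ?case
    using free_vars_propositional by blast
next
  case (Exists x A)
  then have "propositional ar A" "x \<in> free_vars A"
    by (auto simp: propositional_def)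
  then show ?case
    using free_vars_propositional by blast
qed (auto simp: propositional_def)

section \<open>From \<open>LK\<close> to \<open>LJ\<^sup>+\<close>\<close>

text \<open>
  The second alternative arises from the quantifier rules: premise and conclusion differ there only
  in a quantifier and a substitution, both of which are erased.
\<close>

lemma LJ_erase:
  assumes "LJ Ps S"
  shows "LJ (map (erase_sequent ar) Ps) (erase_sequent ar S)
    \<or> erase_sequent ar S \<in> erase_sequent ar ` set Ps"
  using assms
  by (cases rule: LJ.cases) (simp_all add: LJ.intros)

lemma LJ_plus_excluded_middle:
  assumes "propositional ar A"
  shows "derivable_sequent ar (LJ_plus ar) ([] \<turnstile> Some (Disj A (Neg A)))"
proof -
  have A: "formula ar A"
    using assms by (simp add: propositional_def)
  have rule: "derivable_sequent ar (LJ_plus ar) S"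
    if "LJ Ps S" "\<forall>P \<in> set Ps. derivable_sequent ar (LJ_plus ar) P"
      "\<forall>F \<in> sequent_fms S. formula ar F" for Ps S
    using that by (blast intro: derivable_sequent.intros LJ_plus.LJ)
  have "derivable_sequent ar (LJ_plus ar) ([A] \<turnstile> Some A)"
    by (rule rule[OF ax]) (auto simp: sequent_fms_def A)
  then have 1: "derivable_sequent ar (LJ_plus ar) ([A] \<turnstile> Some (Disj A (Neg A)))"
    by (intro rule[OF Disj_right1]) (auto simp: sequent_fms_def A)
  have "derivable_sequent ar (LJ_plus ar) ([Neg A] \<turnstile> Some (Neg A))"
    by (rule rule[OF ax]) (auto simp: sequent_fms_def A)
  then have 2: "derivable_sequent ar (LJ_plus ar) ([Neg A] \<turnstile> Some (Disj A (Neg A)))"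
    by (intro rule[OF Disj_right2]) (auto simp: sequent_fms_def A)
  show ?thesis
    by (rule derivable_sequent.intros[where R = "LJ_plus ar", OF neutralization[OF assms]])
      (auto simp: sequent_fms_def A 1 2)
qed

lemma LJ_plus_derivable_erase:
  assumes "derivable_sequent ar LK S"
  shows "derivable_sequent ar (LJ_plus ar) (erase_sequent ar S)"
  using assms
proof induction
  case (1 Ps S)
  from \<open>LK Ps S\<close> show ?case
  proof cases
    case LJ
    from LJ_erase[OF this, of ar] show ?thesis
    proof
      assume "LJ (map (erase_sequent ar) Ps) (erase_sequent ar S)"
      then have "LJ_plus ar (map (erase_sequent ar) Ps) (erase_sequent ar S)"
        by (rule LJ_plus.LJ)
      then show ?thesis
        by (rule derivable_sequent.intros) (use 1 formula_erase_sequent in auto)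
    next
      assume "erase_sequent ar S \<in> erase_sequent ar ` set Ps"
      then show ?thesis
        using 1 by auto
    qed
  next
    case (excluded_middle A)
    then show ?thesis
      using LJ_plus_excluded_middle[OF propositional_erase] by simp
  qed
qed

section \<open>From \<open>LJ\<^sup>+\<close> to \<open>LK\<close>\<close>

lemma LK_neutralization:
  assumes N: "formula ar N"
    and \<Gamma>: "\<forall>F \<in> sequent_fms (\<Gamma> \<turnstile> \<Lambda>). formula ar F"
    and pos: "derivable_sequent ar LK (N # \<Gamma> \<turnstile> \<Lambda>)"
    and neg: "derivable_sequent ar LK (Neg N # \<Gamma> \<turnstile> \<Lambda>)"
  shows "derivable_sequent ar LK (\<Gamma> \<turnstile> \<Lambda>)"
proof -
  have em: "derivable_sequent ar LK ([] \<turnstile> Some (Disj N (Neg N)))"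
    by (rule derivable_sequent.intros[where R = LK, OF excluded_middle]) (auto simp: sequent_fms_def N)
  have merged: "derivable_sequent ar LK (Disj N (Neg N) # \<Gamma> \<turnstile> \<Lambda>)"
    by (rule derivable_sequent.intros[where R = LK, OF LK.LJ[OF Disj_left]])
      (use N \<Gamma> pos neg in \<open>auto simp: sequent_fms_def\<close>)
  have "derivable_sequent ar LK ([] @ \<Gamma> \<turnstile> \<Lambda>)"
    by (rule derivable_sequent.intros[where R = LK, OF LK.LJ[OF cut]]) (use \<Gamma> em merged in auto)
  then show ?thesis
    by simp
qed

lemma LK_derivable_if_LJ_plus_derivable:
  assumes "derivable_sequent ar (LJ_plus ar) S"
  shows "derivable_sequent ar LK S"
  using assms
proof induction
  case (1 Ps S)
  from \<open>LJ_plus ar Ps S\<close> show ?case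
  proof cases
    case LJ
    show ?thesis
      by (rule derivable_sequent.intros[where R = LK, OF LK.LJ[OF LJ]]) (use 1 in auto)
  next
    case (neutralization N \<Gamma> \<Lambda>)
    then show ?thesis
      using 1 LK_neutralization[of ar N \<Gamma> \<Lambda>] by (simp add: propositional_def)
  qed
qed

section \<open>Equivalence of the two calculi on propositional formulas\<close>

theorem mainTheorem1:
  fixes ar :: "'r \<Rightarrow> nat" and A :: "'r fm"
  assumes "propositional ar A"
  shows "derivable ar (LJ_plus ar) A \<longleftrightarrow> derivable ar LK A"
proof
  assume "derivable ar (LJ_plus ar) A"
  then show "derivable ar LK A"
    unfolding derivable_def by (rule LK_derivable_if_LJ_plus_derivable)
next
  assume "derivable ar LK A"
  then have "derivable_sequent ar (LJ_plus ar) (erase_sequent ar ([] \<turnstile> Some A))"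
    unfolding derivable_def by (rule LJ_plus_derivable_erase)
  then show "derivable ar (LJ_plus ar) A"
    by (simp add: derivable_def erase_propositional[OF assms])
qed

end
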